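(* Let $a,b,c,d\in\mathbb{R}$ with $a^2+c^2\neq0$, $b^2+d^2\neq0$ and $ad-bc\neq0$, and let $\mathfrak{g}_{a,b,c,d}$ be the $7$-dimensional real Lie algebra with basis $\{e_1,\ldots,e_7\}$ and nonzero brackets $$[e_1,e_4]=ae_5,\ [e_1,e_5]=-ae_4,\ [e_1,e_6]=be_7,\ [e_1,e_7]=-be_6,$$ $$[e_2,e_4]=ce_5,\ [e_2,e_5]=-ce_4,\ [e_2,e_6]=de_7,\ [e_2,e_7]=-de_6.$$ Then $\mathfrak{g}_{a,b,c,d}$ does not admit any closed $G_2$-structure.
   Context: A $G_2$-structure on a $7$-dimensional real Lie algebra $\mathfrak{g}$ is a $3$-form $\varphi\in\bigwedge^3\mathfrak{g}^*$ for which there exists a basis $\{f^1,\ldots,f^7\}$ of $\mathfrak{g}^*$ such that $\varphi=f^{123}+f^{145}+f^{167}+f^{246}-f^{257}-f^{347}-f^{356}$, where $f^{ijk}=f^i\wedge f^j\wedge f^k$. It is closed if $d\varphi=0$, where $d$ is the Chevalley–Eilenberg differential. *)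

theory Defs
  imports "HOL-Analysis.Analysis"
begin

definition lie_bracket :: "('g::real_vector \<Rightarrow> 'g \<Rightarrow> 'g) \<Rightarrow> bool" where
  "lie_bracket br \<longleftrightarrow>
     bilinear br \<and> (\<forall>x. br x x = 0) \<and>
     (\<forall>x y z. br x (br y z) + br y (br z x) + br z (br x y) = 0)"

definition three_form :: "('g::real_vector \<Rightarrow> 'g \<Rightarrow> 'g \<Rightarrow> real) \<Rightarrow> bool" where
  "three_form \<phi> \<longleftrightarrow>
     (\<forall>y z. linear (\<lambda>x. \<phi> x y z)) \<and> (\<forall>x z. linear (\<lambda>y. \<phi> x y z)) \<and>
     (\<forall>x y. linear (\<lambda>z. \<phi> x y z)) \<and>
     (\<forall>x y. \<phi> x x y = 0 \<and> \<phi> x y x = 0 \<and> \<phi> y x x = 0)"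

text \<open>
  In finite dimension every linear functional is bounded, so the dual space of \<open>'g\<close> is
  the vector space \<open>'g \<Rightarrow>\<^sub>L real\<close>. The wedge product uses the determinant convention
  (no factor 1/6).
\<close>

definition wedge3 ::
  "('g::euclidean_space \<Rightarrow>\<^sub>L real) \<Rightarrow> ('g \<Rightarrow>\<^sub>L real) \<Rightarrow> ('g \<Rightarrow>\<^sub>L real) \<Rightarrow> 'g \<Rightarrow> 'g \<Rightarrow> 'g \<Rightarrow> real" where
  "wedge3 \<alpha> \<beta> \<gamma> x y z =
     det (vector [vector [\<alpha> x, \<alpha> y, \<alpha> z],
                  vector [\<beta> x, \<beta> y, \<beta> z],
                  vector [\<gamma> x, \<gamma> y, \<gamma> z]] :: real^3^3)"

definition dual_basis7 :: "(nat \<Rightarrow> ('g::euclidean_space \<Rightarrow>\<^sub>L real)) \<Rightarrow> bool" where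
  "dual_basis7 f \<longleftrightarrow>
     inj_on f {1..7} \<and> independent (f ` {1..7}) \<and> span (f ` {1..7}) = UNIV"

text \<open>\<open>dual_basis7\<close> forces \<open>DIM('g) = 7\<close>.\<close>

definition G2_structure :: "('g::euclidean_space \<Rightarrow> 'g \<Rightarrow> 'g \<Rightarrow> real) \<Rightarrow> bool" where
  "G2_structure \<phi> \<longleftrightarrow> three_form \<phi> \<and>
     (\<exists>f. dual_basis7 f \<and>
       (\<forall>x y z. \<phi> x y z =
          wedge3 (f 1) (f 2) (f 3) x y z + wedge3 (f 1) (f 4) (f 5) x y z
        + wedge3 (f 1) (f 6) (f 7) x y z + wedge3 (f 2) (f 4) (f 6) x y z
        - wedge3 (f 2) (f 5) (f 7) x y z - wedge3 (f 3) (f 4) (f 7) x y z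
        - wedge3 (f 3) (f 5) (f 6) x y z))"

text \<open>
  The Chevalley--Eilenberg differential in degree 3 (trivial coefficients):
  \<open>(d\<phi>)(x\<^sub>0, \<dots>, x\<^sub>3)\<close> is the sum over \<open>i < j\<close> of
  \<open>(-1)^(i+j) \<phi>([x\<^sub>i, x\<^sub>j], \<dots>)\<close>, the dots being the remaining arguments in order.
\<close>

definition CE_d3 ::
  "('g \<Rightarrow> 'g \<Rightarrow> 'g) \<Rightarrow> ('g \<Rightarrow> 'g \<Rightarrow> 'g \<Rightarrow> real) \<Rightarrow> 'g \<Rightarrow> 'g \<Rightarrow> 'g \<Rightarrow> 'g \<Rightarrow> real" where
  "CE_d3 br \<phi> x0 x1 x2 x3 =
     - \<phi> (br x0 x1) x2 x3 + \<phi> (br x0 x2) x1 x3 - \<phi> (br x0 x3) x1 x2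
     - \<phi> (br x1 x2) x0 x3 + \<phi> (br x1 x3) x0 x2 - \<phi> (br x2 x3) x0 x1"

definition closed_G2_structure ::
  "('g::euclidean_space \<Rightarrow> 'g \<Rightarrow> 'g) \<Rightarrow> ('g \<Rightarrow> 'g \<Rightarrow> 'g \<Rightarrow> real) \<Rightarrow> bool" where
  "closed_G2_structure br \<phi> \<longleftrightarrow>
     G2_structure \<phi> \<and> (\<forall>x0 x1 x2 x3. CE_d3 br \<phi> x0 x1 x2 x3 = 0)"

text \<open>
  The algebra \<open>\<gg>\<^sub>a\<^sub>b\<^sub>c\<^sub>d\<close> lives on \<open>real^7\<close>, with its standard basis. In the index type
  \<open>7\<close> the numeral \<open>7\<close> equals \<open>0\<close>, so the indices \<open>1, \<dots>, 7\<close> are exactly its elements.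
\<close>

definition e :: "7 \<Rightarrow> real^7" where
  "e i = axis i 1"

definition e_wedge :: "7 \<Rightarrow> 7 \<Rightarrow> real^7 \<Rightarrow> real^7 \<Rightarrow> real" where
  "e_wedge i j x y = x $ i * y $ j - x $ j * y $ i"

definition g_bracket :: "real \<Rightarrow> real \<Rightarrow> real \<Rightarrow> real \<Rightarrow> real^7 \<Rightarrow> real^7 \<Rightarrow> real^7" where
  "g_bracket a b c d x y =
       (a * e_wedge 1 4 x y + c * e_wedge 2 4 x y) *\<^sub>R e 5 - (a * e_wedge 1 5 x y + c * e_wedge 2 5 x y) *\<^sub>R e 4
     + (b * e_wedge 1 6 x y + d * e_wedge 2 6 x y) *\<^sub>R e 7 - (b * e_wedge 1 7 x y + d * e_wedge 2 7 x y) *\<^sub>R e 6"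

lemma exhaust_7: "(i::7) = 1 \<or> i = 2 \<or> i = 3 \<or> i = 4 \<or> i = 5 \<or> i = 6 \<or> i = 7"
proof (induct i)
  case (of_int z)
  then have "0 \<le> z" and "z < 7" by simp_all
  then have "z = 0 \<or> z = 1 \<or> z = 2 \<or> z = 3 \<or> z = 4 \<or> z = 5 \<or> z = 6" by arith
  then show ?case by auto
qed

lemma g_bracket_basis:
  "g_bracket a b c d (e 1) (e 4) = a *\<^sub>R e 5" "g_bracket a b c d (e 1) (e 5) = - a *\<^sub>R e 4"
  "g_bracket a b c d (e 1) (e 6) = b *\<^sub>R e 7" "g_bracket a b c d (e 1) (e 7) = - b *\<^sub>R e 6"
  "g_bracket a b c d (e 2) (e 4) = c *\<^sub>R e 5" "g_bracket a b c d (e 2) (e 5) = - c *\<^sub>R e 4"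
  "g_bracket a b c d (e 2) (e 6) = d *\<^sub>R e 7" "g_bracket a b c d (e 2) (e 7) = - d *\<^sub>R e 6"
  by (simp_all add: g_bracket_def e_wedge_def e_def axis_def)

lemma g_bracket_basis_zero:
  assumes "\<not> (i \<in> {1, 2} \<and> j \<in> {4, 5, 6, 7})" and "\<not> (j \<in> {1, 2} \<and> i \<in> {4, 5, 6, 7})"
  shows "g_bracket a b c d (e i) (e j) = 0"
  using assms exhaust_7[of i] exhaust_7[of j]
  by (elim disjE) (simp_all add: g_bracket_def e_wedge_def e_def axis_def)

lemma lie_bracket_g_bracket: "lie_bracket (g_bracket a b c d)"
  unfolding lie_bracket_def
proof (intro conjI allI)
  show "bilinear (g_bracket a b c d)"
    unfolding bilinear_def
    by (auto intro!: linearI simp: g_bracket_def e_wedge_def algebra_simps)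
  show "g_bracket a b c d x x = 0" for x
    by (simp add: g_bracket_def e_wedge_def)
  show "g_bracket a b c d x (g_bracket a b c d y z) + g_bracket a b c d y (g_bracket a b c d z x)
      + g_bracket a b c d z (g_bracket a b c d x y) = 0" for x y z
  proof -
    have "(g_bracket a b c d x (g_bracket a b c d y z) + g_bracket a b c d y (g_bracket a b c d z x)
      + g_bracket a b c d z (g_bracket a b c d x y)) $ i = 0" for i
      using exhaust_7[of i]
      by (elim disjE) (simp_all add: g_bracket_def e_wedge_def e_def axis_def algebra_simps)
    then show ?thesis by (simp add: vec_eq_iff)
  qed
qed

end

theory Submission
  imports Defs
begin

text \<open>
  A \<open>G\<^sub>2\<close>-form is nondegenerate: by the Lagrange identity for the seven-dimensional cross product,
  \<open>\<phi> x y \<cdot> = 0\<close> forces \<open>x\<close> and \<open>y\<close> to be linearly dependent. On the other hand, if \<open>\<phi>\<close> is closed,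
  then it vanishes on the abelian ideal \<open>\<langle>e\<^sub>4, \<dots>, e\<^sub>7\<rangle>\<close>, and \<open>\<phi> (e 3)\<close> vanishes on
  \<open>\<langle>e\<^sub>4, e\<^sub>5\<rangle> \<times> \<langle>e\<^sub>6, e\<^sub>7\<rangle>\<close>. Identify both planes with \<open>\<complex>\<close>. The
  pairings \<open>\<phi> (e 1) w u\<close> and \<open>\<phi> (e 2) w u\<close> split into a complex bilinear and a sesquilinear part;
  closedness makes the parts of \<open>\<phi> (e 1)\<close> and \<open>\<phi> (e 2)\<close> proportional to common forms
  \<open>Re (\<lambda> w u)\<close> and \<open>Re (\<mu> w (cnj u))\<close>. Choosing \<open>arg w + arg u\<close> and \<open>arg w - arg u\<close> suitably makes
  both vanish, which yields independent \<open>w\<close>, \<open>u\<close> with \<open>\<phi> w u \<cdot> = 0\<close>.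
\<close>

lemma three_form_swap:
  assumes "three_form \<phi>"
  shows "\<phi> y x z = - \<phi> x y z" and "\<phi> x z y = - \<phi> x y z"
proof -
  have l: "linear (\<lambda>x. \<phi> x y z)" "linear (\<lambda>y. \<phi> x y z)" "linear (\<lambda>z. \<phi> x y z)"
    and a: "\<phi> x x y = 0" "\<phi> x y y = 0" for x y z
    using assms by (auto simp: three_form_def)
  have "\<phi> (x + y) (x + y) z = (\<phi> x x z + \<phi> x y z) + (\<phi> y x z + \<phi> y y z)"
    by (simp only: linear_add[OF l(1)] linear_add[OF l(2)])
  then show "\<phi> y x z = - \<phi> x y z" by (simp add: a)
  have "\<phi> x (y + z) (y + z) = (\<phi> x y y + \<phi> x y z) + (\<phi> x z y + \<phi> x z z)"
    by (simp only: linear_add[OF l(2)] linear_add[OF l(3)])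
  then show "\<phi> x z y = - \<phi> x y z" by (simp add: a)
qed

lemma dual_basis7_independent:
  assumes "dual_basis7 f" and "(\<Sum>i\<in>{1..7}. c i *\<^sub>R f i) = 0" and "i \<in> {1..7}"
  shows "c i = 0"
proof -
  have inj: "inj_on f {1..7}" and ind: "independent (f ` {1..7})"
    using assms(1) by (auto simp: dual_basis7_def)
  define u where "u = c \<circ> inv_into {1..7} f"
  have u: "u (f i) = c i" if "i \<in> {1..7}" for i :: nat
    using that inj by (simp add: u_def del: atLeastAtMost_iff)
  have "(\<Sum>v\<in>f ` {1..7}. u v *\<^sub>R v) = 0"
    using assms(2) u by (subst sum.reindex[OF inj]) (simp del: atLeastAtMost_iff)
  then have "u (f i) = 0"
    using independentD[OF ind, of "f ` {1..7}" u] assms(3) by blast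
  with u assms(3) show ?thesis by simp
qed

text \<open>The functional "inner product with \<open>x\<close>" is a combination of the
  \<open>f i\<close>, so it kills \<open>x\<close>, i.e. \<open>x\<close> has norm 0.\<close>

lemma dual_basis7_separates:
  assumes "dual_basis7 f" and "\<And>i. i \<in> {1..7} \<Longrightarrow> f i x = 0"
  shows "x = 0"
proof -
  have "blinfun_inner_left x \<in> span (f ` {1..7})"
    using assms(1) by (simp add: dual_basis7_def)
  then have "blinfun_inner_left x x = 0"
  proof (induction rule: span_induct_alt)
    case (step c g h)
    then show ?case using assms(2) by (auto simp: blinfun.add_left blinfun.scaleR_left)
  qed simp
  then show ?thesis by simp
qed

lemma G2_structure_nondegenerate:
  assumes "G2_structure \<phi>" and null: "\<And>z. \<phi> x y z = 0" and "x \<noteq> 0"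
  shows "\<exists>k. y = k *\<^sub>R x"
proof -
  obtain f where f: "dual_basis7 f"
    and \<phi>: "\<And>x y z. \<phi> x y z =
          wedge3 (f 1) (f 2) (f 3) x y z + wedge3 (f 1) (f 4) (f 5) x y z
        + wedge3 (f 1) (f 6) (f 7) x y z + wedge3 (f 2) (f 4) (f 6) x y z
        - wedge3 (f 2) (f 5) (f 7) x y z - wedge3 (f 3) (f 4) (f 7) x y z
        - wedge3 (f 3) (f 5) (f 6) x y z"
    using assms(1) unfolding G2_structure_def by blast
  define m where "m i j = f i x * f j y - f j x * f i y" for i j :: nat
  \<comment> \<open>\<open>c i\<close> is the coefficient of \<open>f i\<close> in the functional
    \<open>\<phi> x y\<close>; the \<open>m i j\<close> are the Pluecker coordinates of the pair
    \<open>x\<close>, \<open>y\<close>.\<close>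
  define c :: "nat \<Rightarrow> real" where "c = (\<lambda>_. 0)(1 := m 2 3 + m 4 5 + m 6 7, 2 := - m 1 3 + m 4 6 - m 5 7,
     3 := m 1 2 - m 4 7 - m 5 6, 4 := - m 1 5 - m 2 6 + m 3 7, 5 := m 1 4 + m 2 7 + m 3 6,
     6 := - m 1 7 + m 2 4 - m 3 5, 7 := m 1 6 - m 2 5 - m 3 4)"
  have c: "c 1 = m 2 3 + m 4 5 + m 6 7" "c 2 = - m 1 3 + m 4 6 - m 5 7"
    "c 3 = m 1 2 - m 4 7 - m 5 6" "c 4 = - m 1 5 - m 2 6 + m 3 7" "c 5 = m 1 4 + m 2 7 + m 3 6"
    "c 6 = - m 1 7 + m 2 4 - m 3 5" "c 7 = m 1 6 - m 2 5 - m 3 4"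
    by (simp_all add: c_def)
  have set7: "{1..7} = {1, 2, 3, 4, 5, 6, 7::nat}" by auto
  have "blinfun_apply (\<Sum>i\<in>{1..7::nat}. c i *\<^sub>R f i) z = \<phi> x y z" for z
    by (simp add: set7 c m_def \<phi> wedge3_def det_3 vector_3 blinfun.add_left blinfun.scaleR_left
        del: One_nat_def) (simp add: algebra_simps)
  then have "(\<Sum>i\<in>{1..7}. c i *\<^sub>R f i) = 0"
    by (intro blinfun_eqI) (simp add: null)
  then have c0: "c i = 0" if "i \<in> {1..7}" for i :: nat
    using dual_basis7_independent[OF f] that by blast
  \<comment> \<open>In the squares of the \<open>c i\<close> the mixed products cancel by seven
    Pluecker relations, one for the complement of each index triple in the normal form. The factor 2
    appears because the left side counts each pair twice.\<close>
  have lagrange: "(\<Sum>i\<in>{1..7}. \<Sum>j\<in>{1..7}. (m i j)\<^sup>2) = 2 * (\<Sum>i\<in>{1..7}. (c i)\<^sup>2)"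
  proof -
    have plucker: "m i j * m k l - m i k * m j l + m i l * m j k = 0" for i j k l
      unfolding m_def by algebra
    have anti: "m j i = - m i j" "m i i = 0" for i j
      by (simp_all add: m_def)
    have sorted: "m 2 1 = - m 1 2" "m 3 1 = - m 1 3" "m 4 1 = - m 1 4" "m 5 1 = - m 1 5"
      "m 6 1 = - m 1 6" "m 7 1 = - m 1 7" "m 3 2 = - m 2 3" "m 4 2 = - m 2 4" "m 5 2 = - m 2 5"
      "m 6 2 = - m 2 6" "m 7 2 = - m 2 7" "m 4 3 = - m 3 4" "m 5 3 = - m 3 5" "m 6 3 = - m 3 6"
      "m 7 3 = - m 3 7" "m 5 4 = - m 4 5" "m 6 4 = - m 4 6" "m 7 4 = - m 4 7" "m 6 5 = - m 5 6"
      "m 7 5 = - m 5 7" "m 7 6 = - m 6 7"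
      by (rule anti)+
    show ?thesis
      using plucker[of 2 3 4 5] plucker[of 2 3 6 7] plucker[of 4 5 6 7] plucker[of 1 3 4 6]
        plucker[of 1 3 5 7] plucker[of 1 2 4 7] plucker[of 1 2 5 6]
      by (simp add: set7 c anti(2) sorted power2_eq_square algebra_simps del: One_nat_def)
  qed
  have m0: "m i j = 0" if "i \<in> {1..7}" "j \<in> {1..7}" for i j :: nat
  proof -
    have "(\<Sum>i\<in>{1..7}. \<Sum>j\<in>{1..7}. (m i j)\<^sup>2) = 0"
      unfolding lagrange by (simp add: c0)
    then show ?thesis
      using that by (simp add: sum_nonneg_eq_0_iff sum_nonneg)
  qed
  obtain i :: nat where i: "i \<in> {1..7}" "f i x \<noteq> 0"
    using dual_basis7_separates[OF f] \<open>x \<noteq> 0\<close> by blast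
  have "f i x *\<^sub>R y - f i y *\<^sub>R x = 0"
  proof (rule dual_basis7_separates[OF f])
    fix j :: nat assume "j \<in> {1..7}"
    then show "f j (f i x *\<^sub>R y - f i y *\<^sub>R x) = 0"
      using m0[OF i(1), of j] by (simp add: m_def blinfun.diff_right blinfun.scaleR_right mult.commute)
  qed
  then have "y = (f i y / f i x) *\<^sub>R x"
    using i(2) by (simp add: eq_vector_fraction_iff)
  then show ?thesis ..
qed

lemma ex_angle_orthogonal:
  fixes x y :: real
  shows "\<exists>t. x * cos t + y * sin t = 0"
proof -
  \<comment> \<open>\<open>t\<close> is the polar angle of (y, -x), which is orthogonal to (x,
    y).\<close>
  obtain r t where "y = r * cos t" "- x = r * sin t"
    using polar_Ex by blast
  then have "x * cos t + y * sin t = 0" by algebra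
  then show ?thesis ..
qed

text \<open>(x, y) is both parallel and orthogonal to the nonzero vector (p, q).\<close>

lemma proportional_common_factor:
  fixes p q x y :: real
  assumes "p * y = q * x" and "p * x + q * y = 0" and "p \<noteq> 0 \<or> q \<noteq> 0"
  shows "x = 0 \<and> y = 0"
proof -
  have "(p\<^sup>2 + q\<^sup>2) * x = 0" "(p\<^sup>2 + q\<^sup>2) * y = 0"
    using assms(1,2) by algebra+
  then show ?thesis using assms(3) by (auto simp: sum_power2_eq_zero_iff)
qed

text \<open>
  The hypotheses say that the bilinear forms \<open>F\<close> and \<open>G\<close> with these coefficients satisfy
  \<open>a G(Jx, u) + b G(x, Ju) = c F(Jx, u) + d F(x, Ju)\<close> for the rotation \<open>J\<close> by a right angle.
\<close>

lemma common_null_directions: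
  fixes a b c d F46 F47 F56 F57 G46 G47 G56 G57 :: real
  assumes "a * d - b * c \<noteq> 0"
    and "a * G56 + b * G47 = c * F56 + d * F47"
    and "a * G57 - b * G46 = c * F57 - d * F46"
    and "a * G46 - b * G57 = c * F46 - d * F57"
    and "a * G47 + b * G56 = c * F47 + d * F56"
  obtains s t where
    "F46 * (cos s * cos t) + F47 * (cos s * sin t) + F56 * (sin s * cos t) + F57 * (sin s * sin t) = 0"
    "G46 * (cos s * cos t) + G47 * (cos s * sin t) + G56 * (sin s * cos t) + G57 * (sin s * sin t) = 0"
proof -
  \<comment> \<open>By the product formulas, twice the form \<open>F\<close> at angles
    \<open>s\<close>, \<open>t\<close> is a trigonometric expression in \<open>s + t\<close> with
    coefficients \<open>F46 - F57\<close>, \<open>F47 + F56\<close>, plus one in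
    \<open>t - s\<close> with coefficients \<open>F46 + F57\<close>, \<open>F47 - F56\<close>. The
    hypotheses decouple accordingly.\<close>
  have p: "(a + b) * (G46 - G57) = (c + d) * (F46 - F57)"
    "(a + b) * (G47 + G56) = (c + d) * (F47 + F56)"
    "(a - b) * (G46 + G57) = (c - d) * (F46 + F57)"
    "(a - b) * (G47 - G56) = (c - d) * (F47 - F56)"
    using assms(2-5) by (simp_all add: algebra_simps)
  have nz: "a + b \<noteq> 0 \<or> c + d \<noteq> 0" "a - b \<noteq> 0 \<or> c - d \<noteq> 0"
    using assms(1) by algebra+
  \<comment> \<open>One angle can annihilate only one combination of the \<open>F\<close> and
    \<open>G\<close> parts; as these parts are proportional, this choice makes both vanish.\<close>
  obtain A where A: "((a + b) * (F46 - F57) + (c + d) * (G46 - G57)) * cos A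
      + ((a + b) * (F47 + F56) + (c + d) * (G47 + G56)) * sin A = 0"
    using ex_angle_orthogonal by blast
  obtain B where B: "((a - b) * (F46 + F57) + (c - d) * (G46 + G57)) * cos B
      + ((a - b) * (F47 - F56) + (c - d) * (G47 - G56)) * sin B = 0"
    using ex_angle_orthogonal by blast
  have plus: "(F46 - F57) * cos A + (F47 + F56) * sin A = 0 \<and>
      (G46 - G57) * cos A + (G47 + G56) * sin A = 0"
    by (rule proportional_common_factor[OF _ _ nz(1)]; use A p in algebra)
  have minus: "(F46 + F57) * cos B + (F47 - F56) * sin B = 0 \<and>
      (G46 + G57) * cos B + (G47 - G56) * sin B = 0"
    by (rule proportional_common_factor[OF _ _ nz(2)]; use B p in algebra)
  define s t where "s = (A - B) / 2" and "t = (A + B) / 2"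
  have AB: "A = s + t" "B = t - s" by (simp_all add: s_def t_def field_simps)
  show thesis
    by (rule that[of s t]; use plus minus in \<open>simp add: AB cos_add sin_add cos_diff sin_diff\<close>; algebra)
qed

lemma linear_eq_0_on_e:
  fixes h :: "real^7 \<Rightarrow> real"
  assumes "linear h" and "h (e 1) = 0" "h (e 2) = 0" "h (e 3) = 0" "h (e 4) = 0" "h (e 5) = 0"
    "h (e 6) = 0" "h (e 7) = 0"
  shows "h z = 0"
proof -
  have "h (e i) = 0" for i using exhaust_7[of i] assms(2-) by auto
  then have "h b = 0" if "b \<in> Basis" for b
    using that by (auto simp: Basis_vec_def e_def)
  then have "h = (\<lambda>_. 0)"
    by (intro linear_eq_stdbasis assms(1) linear_zero)
  then show ?thesis by simp
qed

theorem proposition4p5: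
  fixes a b c d :: real
  assumes "a\<^sup>2 + c\<^sup>2 \<noteq> 0" and "b\<^sup>2 + d\<^sup>2 \<noteq> 0" and "a * d - b * c \<noteq> 0"
  shows "\<not> (\<exists>\<phi>. closed_G2_structure (g_bracket a b c d) \<phi>)"
proof
  assume "\<exists>\<phi>. closed_G2_structure (g_bracket a b c d) \<phi>"
  then obtain \<phi> where G2: "G2_structure \<phi>"
    and closed: "\<And>x0 x1 x2 x3. CE_d3 (g_bracket a b c d) \<phi> x0 x1 x2 x3 = 0"
    unfolding closed_G2_structure_def by blast
  have tf: "three_form \<phi>" using G2 by (simp add: G2_structure_def)
  have l: "linear (\<lambda>x. \<phi> x y z)" "linear (\<lambda>y. \<phi> x y z)" "linear (\<lambda>z. \<phi> x y z)"
    and alt: "\<phi> x x y = 0" "\<phi> x y x = 0" "\<phi> x y y = 0" for x y z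
    using tf by (auto simp: three_form_def)
  note lin = linear_add[OF l(1)] linear_add[OF l(2)] linear_add[OF l(3)]
    linear_cmul[OF l(1)] linear_cmul[OF l(2)] linear_cmul[OF l(3)]
    linear_neg[OF l(1)] linear_neg[OF l(2)] linear_neg[OF l(3)]
    linear_0[OF l(1)] linear_0[OF l(2)] linear_0[OF l(3)]
  \<comment> \<open>Listing only increasing pairs makes the rewriting stop once the arguments are
    sorted.\<close>
  have sort: "\<phi> (e j) (e i) z = - \<phi> (e i) (e j) z" "\<phi> z (e j) (e i) = - \<phi> z (e i) (e j)"
    if "(i, j) \<in> {(1, 2), (1, 3), (1, 4), (1, 5), (1, 6), (1, 7), (2, 3), (2, 4), (2, 5), (2, 6),
      (2, 7), (3, 4), (3, 5), (3, 6), (3, 7), (4, 5), (4, 6), (4, 7), (5, 6), (5, 7), (6, 7)}"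
    for i j z
    by (rule three_form_swap[OF tf])+
  note expand = CE_d3_def g_bracket_basis g_bracket_basis_zero lin alt sort
  \<comment> \<open>Rotations preserve the area of the plane of \<open>e 4\<close>,
    \<open>e 5\<close>, so only the rotation of \<open>e 6\<close>, \<open>e 7\<close> contributes,
    with factor \<open>b\<close> or \<open>d\<close>, not both zero.\<close>
  have V45: "\<phi> (e 4) (e 5) (e 6) = 0" "\<phi> (e 4) (e 5) (e 7) = 0"
    using closed[of "e 1" "e 4" "e 5" "e 6"] closed[of "e 2" "e 4" "e 5" "e 6"]
      closed[of "e 1" "e 4" "e 5" "e 7"] closed[of "e 2" "e 4" "e 5" "e 7"] assms(2)
    by (simp_all add: expand) auto
  have V67: "\<phi> (e 4) (e 6) (e 7) = 0" "\<phi> (e 5) (e 6) (e 7) = 0"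
    using closed[of "e 1" "e 4" "e 6" "e 7"] closed[of "e 2" "e 4" "e 6" "e 7"]
      closed[of "e 1" "e 5" "e 6" "e 7"] closed[of "e 2" "e 5" "e 6" "e 7"] assms(1)
    by (simp_all add: expand) auto
  have 3: "\<phi> (e 3) (e 4) (e 6) = 0" "\<phi> (e 3) (e 4) (e 7) = 0"
    "\<phi> (e 3) (e 5) (e 6) = 0" "\<phi> (e 3) (e 5) (e 7) = 0"
  proof -
    have "x = 0 \<and> y = 0" if "a * x + b * y = 0" "c * x + d * y = 0" for x y
    proof -
      have "(a * d - b * c) * x = 0" "(a * d - b * c) * y = 0"
        using that by algebra+
      then show ?thesis using assms(3) by simp
    qed
    note cramer = this
    \<comment> \<open>Since \<open>e 3\<close> is central, closedness with \<open>e 1\<close> and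
      with \<open>e 2\<close> gives a 2 by 2 system of determinant
      \<open>a * d - b * c\<close>.\<close>
    have "\<phi> (e 3) (e 5) (e 6) = 0 \<and> \<phi> (e 3) (e 4) (e 7) = 0"
      using closed[of "e 1" "e 3" "e 4" "e 6"] closed[of "e 2" "e 3" "e 4" "e 6"]
      by (intro cramer) (simp_all add: expand)
    moreover have "\<phi> (e 3) (e 5) (e 7) = 0 \<and> - \<phi> (e 3) (e 4) (e 6) = 0"
      using closed[of "e 1" "e 3" "e 4" "e 7"] closed[of "e 2" "e 3" "e 4" "e 7"]
      by (intro cramer) (simp_all add: expand)
    ultimately show "\<phi> (e 3) (e 4) (e 6) = 0" "\<phi> (e 3) (e 4) (e 7) = 0"
      "\<phi> (e 3) (e 5) (e 6) = 0" "\<phi> (e 3) (e 5) (e 7) = 0" by auto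
  qed
  obtain s t where
    F: "\<phi> (e 1) (e 4) (e 6) * (cos s * cos t) + \<phi> (e 1) (e 4) (e 7) * (cos s * sin t)
      + \<phi> (e 1) (e 5) (e 6) * (sin s * cos t) + \<phi> (e 1) (e 5) (e 7) * (sin s * sin t) = 0"
    and G: "\<phi> (e 2) (e 4) (e 6) * (cos s * cos t) + \<phi> (e 2) (e 4) (e 7) * (cos s * sin t)
      + \<phi> (e 2) (e 5) (e 6) * (sin s * cos t) + \<phi> (e 2) (e 5) (e 7) * (sin s * sin t) = 0"
  proof (rule common_null_directions[OF assms(3)])
    show "a * \<phi> (e 2) (e 5) (e 6) + b * \<phi> (e 2) (e 4) (e 7)
        = c * \<phi> (e 1) (e 5) (e 6) + d * \<phi> (e 1) (e 4) (e 7)"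
      using closed[of "e 1" "e 2" "e 4" "e 6"] by (simp add: expand)
    show "a * \<phi> (e 2) (e 5) (e 7) - b * \<phi> (e 2) (e 4) (e 6)
        = c * \<phi> (e 1) (e 5) (e 7) - d * \<phi> (e 1) (e 4) (e 6)"
      using closed[of "e 1" "e 2" "e 4" "e 7"] by (simp add: expand)
    show "a * \<phi> (e 2) (e 4) (e 6) - b * \<phi> (e 2) (e 5) (e 7)
        = c * \<phi> (e 1) (e 4) (e 6) - d * \<phi> (e 1) (e 5) (e 7)"
      using closed[of "e 1" "e 2" "e 5" "e 6"] by (simp add: expand)
    show "a * \<phi> (e 2) (e 4) (e 7) + b * \<phi> (e 2) (e 5) (e 6)
        = c * \<phi> (e 1) (e 4) (e 7) + d * \<phi> (e 1) (e 5) (e 6)"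
      using closed[of "e 1" "e 2" "e 5" "e 7"] by (simp add: expand)
  qed
  define x y where "x = cos s *\<^sub>R e 4 + sin s *\<^sub>R e 5" and "y = cos t *\<^sub>R e 6 + sin t *\<^sub>R e 7"
  have xy: "\<phi> z x y = \<phi> z (e 4) (e 6) * (cos s * cos t) + \<phi> z (e 4) (e 7) * (cos s * sin t)
      + \<phi> z (e 5) (e 6) * (sin s * cos t) + \<phi> z (e 5) (e 7) * (sin s * sin t)" for z
    by (simp add: x_def y_def lin algebra_simps)
  have "\<phi> z x y = 0" for z
  proof (rule linear_eq_0_on_e[OF l(1)])
    show "\<phi> (e 1) x y = 0" "\<phi> (e 2) x y = 0"
      by (simp_all only: xy F G)
    show "\<phi> (e 3) x y = 0" "\<phi> (e 4) x y = 0" "\<phi> (e 5) x y = 0" "\<phi> (e 6) x y = 0" "\<phi> (e 7) x y = 0"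
      by (simp_all add: xy 3 V45 V67 alt sort)
  qed
  then have "\<phi> x y z = 0" for z
    using three_form_swap[OF tf, of x z y] three_form_swap[OF tf, of z x y] by simp
  moreover have xs: "x $ 4 = cos s" "x $ 5 = sin s" "x $ 6 = 0" "x $ 7 = 0"
    and ys: "y $ 6 = cos t" "y $ 7 = sin t"
    by (simp_all add: x_def y_def e_def axis_def)
  moreover have "x \<noteq> 0"
    using xs(1,2) sin_zero_abs_cos_one[of s] by auto
  ultimately obtain k where "y = k *\<^sub>R x"
    using G2_structure_nondegenerate[OF G2] by blast
  \<comment> \<open>\<open>x\<close> and \<open>y\<close> lie in complementary planes, so
    proportionality would force the unit vector \<open>y\<close> to vanish.\<close>
  then have "y $ 6 = k * x $ 6" "y $ 7 = k * x $ 7"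
    by simp_all
  then have "sin t = 0" "cos t = 0"
    using xs ys by simp_all
  then show False using sin_zero_abs_cos_one[of t] by simp
qed

end
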